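(* Let $A$ be a non-empty set and let $i:A\to\mathbb{R}^{\mathbb{R}^A}$ be the embedding $i(a):=\delta_a$, where $\delta_a(\xi)=\xi(a)$ for $\xi\in\mathbb{R}^A$. Let $F$ be the intersection of all vector sublattices of the UCVL $\mathbb{R}^{\mathbb{R}^A}$ that are UCVLs and contain $i(A)$. Then $F$ together with the embedding $i$ (regarded as a map $A\to F$) is a free UCVL over $A$.
   Context: All vector lattices are real; $\mathbb{R}^{\mathbb{R}^A}$ is the vector lattice of all real-valued functions on $\mathbb{R}^A$ with pointwise operations and order. A net $x_\alpha$ in a vector lattice $V$ r-converges to $x\in V$ with regulator $u\in V$ if for each $k\in\mathbb{N}$ there is $\alpha_k$ with $|x_\alpha-x|\le\frac1k|u|$ for all $\alpha\ge\alpha_k$. It is r$(u)$-Cauchy (with $u\in V$) if for each $k\in\mathbb{N}$ there is $\alpha_k$ with $|x_{\alpha'}-x_{\alpha''}|\le\frac1k|u|$ for all $\alpha',\alpha''\ge\alpha_k$. A UCVL (uniformly complete vector lattice) is an Archimedean vector lattice $V$ such that for every $u\in V$, every r$(u)$-Cauchy net in $V$ r-converges to some element of $V$ with some regulator in $V$ (sequences suffice). A free UCVL over $A$ (denoted $\mathrm{FUCVL}(A)$) is a pair $(F,f)$ with $F$ a UCVL and $f:A\to F$ an embedding (injective map) such that for every UCVL $E$ and every embedding (injective map) $q:A\to E$ there is a unique Riesz homomorphism $T:F\to E$ with $q=T\circ f$. *)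

theory Defs
  imports
    Complex_Main
    "HOL-Library.FuncSet"
    "HOL-Library.Function_Algebras"
    "HOL-Library.Lattice_Algebras"
begin

section \<open>Real vector lattices\<close>

text \<open>The modulus is the library's \<^prop>\<open>\<bar>a\<bar> = sup a (- a)\<close>.\<close>

class vector_lattice = ordered_real_vector + lattice_ab_group_add_abs

instance real :: vector_lattice ..

instantiation "fun" :: (type, real_vector) real_vector
begin

definition scaleR_fun :: "real \<Rightarrow> ('a \<Rightarrow> 'b) \<Rightarrow> 'a \<Rightarrow> 'b"
  where "scaleR_fun c f = (\<lambda>x. c *\<^sub>R f x)"

instance
  by standard (simp_all add: scaleR_fun_def fun_eq_iff plus_fun_def scaleR_add_right scaleR_add_left)

end

instantiation "fun" :: (type, vector_lattice) vector_lattice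
begin

definition abs_fun :: "('a \<Rightarrow> 'b) \<Rightarrow> 'a \<Rightarrow> 'b"
  where "abs_fun f = (\<lambda>x. \<bar>f x\<bar>)"

instance
  by standard
    (simp_all add: scaleR_fun_def abs_fun_def le_fun_def fun_eq_iff abs_lattice
      scaleR_left_mono scaleR_right_mono)

end

definition vector_sublattice :: "'v::vector_lattice set \<Rightarrow> bool"
  where "vector_sublattice V \<longleftrightarrow>
    subspace V \<and> (\<forall>x\<in>V. \<forall>y\<in>V. sup x y \<in> V) \<and> (\<forall>x\<in>V. \<forall>y\<in>V. inf x y \<in> V)"

definition riesz_hom_on :: "'v::vector_lattice set \<Rightarrow> ('v \<Rightarrow> 'w::vector_lattice) \<Rightarrow> bool"
  where "riesz_hom_on V T \<longleftrightarrow>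
    (\<forall>x\<in>V. \<forall>y\<in>V. T (x + y) = T x + T y) \<and>
    (\<forall>c. \<forall>x\<in>V. T (c *\<^sub>R x) = c *\<^sub>R T x) \<and>
    (\<forall>x\<in>V. \<forall>y\<in>V. T (sup x y) = sup (T x) (T y)) \<and>
    (\<forall>x\<in>V. \<forall>y\<in>V. T (inf x y) = inf (T x) (T y))"

definition archimedean_on :: "'v::vector_lattice set \<Rightarrow> bool"
  where "archimedean_on V \<longleftrightarrow>
    (\<forall>x\<in>V. \<forall>y\<in>V. 0 \<le> x \<and> (\<forall>n::nat. real n *\<^sub>R x \<le> y) \<longrightarrow> x = 0)"


section \<open>Relative uniform convergence and uniform completeness\<close>

definition r_converges :: "('i::preorder \<Rightarrow> 'v::vector_lattice) \<Rightarrow> 'v \<Rightarrow> 'v \<Rightarrow> bool"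
  where "r_converges x l u \<longleftrightarrow>
    (\<forall>k::nat. k \<ge> 1 \<longrightarrow> (\<exists>m. \<forall>i\<ge>m. \<bar>x i - l\<bar> \<le> (1 / real k) *\<^sub>R \<bar>u\<bar>))"

definition r_Cauchy :: "('i::preorder \<Rightarrow> 'v::vector_lattice) \<Rightarrow> 'v \<Rightarrow> bool"
  where "r_Cauchy x u \<longleftrightarrow>
    (\<forall>k::nat. k \<ge> 1 \<longrightarrow>
      (\<exists>m. \<forall>i\<ge>m. \<forall>j\<ge>m. \<bar>x i - x j\<bar> \<le> (1 / real k) *\<^sub>R \<bar>u\<bar>))"

text \<open>
  Vector lattices occur as vector sublattices \<open>V\<close> of a type of class \<^class>\<open>vector_lattice\<close>;
  a type itself is the case \<open>V = UNIV\<close>. Limits and regulators are taken in \<open>V\<close>.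
  Completeness is required for sequences, since index types of nets cannot be
  quantified inside a definition; \<open>ucvl_net_convergent\<close> below yields it for all nets.
\<close>

definition ucvl :: "'v::vector_lattice set \<Rightarrow> bool"
  where "ucvl V \<longleftrightarrow>
    vector_sublattice V \<and> archimedean_on V \<and>
    (\<forall>u\<in>V. \<forall>x::nat \<Rightarrow> 'v. range x \<subseteq> V \<and> r_Cauchy x u \<longrightarrow>
      (\<exists>l\<in>V. \<exists>v\<in>V. r_converges x l v))"

lemma ucvl_net_convergent:
  fixes x :: "'i::preorder \<Rightarrow> 'v::vector_lattice"
  assumes V: "ucvl V"
    and directed: "\<And>a b::'i. \<exists>c. a \<le> c \<and> b \<le> c"
    and x: "range x \<subseteq> V" and u: "u \<in> V" and cauchy: "r_Cauchy x u"
  shows "\<exists>l\<in>V. \<exists>v\<in>V. r_converges x l v"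
proof -
  have "\<exists>m. \<forall>i\<ge>m. \<forall>j\<ge>m. \<bar>x i - x j\<bar> \<le> (1 / real (Suc k)) *\<^sub>R \<bar>u\<bar>" for k
    using cauchy[unfolded r_Cauchy_def, rule_format, of "Suc k"] by auto
  then obtain m where
    m: "\<And>k i j. m k \<le> i \<Longrightarrow> m k \<le> j \<Longrightarrow> \<bar>x i - x j\<bar> \<le> (1 / real (Suc k)) *\<^sub>R \<bar>u\<bar>"
    by metis
  obtain ub where ub: "\<And>a b::'i. a \<le> ub a b" "\<And>a b::'i. b \<le> ub a b"
    using directed by metis
  define s where "s = rec_nat (m 0) (\<lambda>n i. ub i (m (Suc n)))"
  have s_Suc: "s (Suc n) = ub (s n) (m (Suc n))" for n
    by (simp add: s_def)
  have m_le_s: "m n \<le> s n" for n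
    by (cases n) (simp_all add: s_def ub)
  have s_mono: "p \<le> q \<Longrightarrow> s p \<le> s q" for p q
    by (induction rule: dec_induct) (auto simp: s_Suc intro: order_trans ub)
  have m_le: "m p \<le> s q" if "p \<le> q" for p q
    using m_le_s[of p] s_mono[OF that] by (rule order_trans)
  have "r_Cauchy (\<lambda>n. x (s n)) u"
    unfolding r_Cauchy_def
  proof (intro allI impI)
    fix k :: nat assume "k \<ge> 1"
    then obtain p where k: "k = Suc p" by (cases k) auto
    show "\<exists>n0. \<forall>i\<ge>n0. \<forall>j\<ge>n0. \<bar>x (s i) - x (s j)\<bar> \<le> (1 / real k) *\<^sub>R \<bar>u\<bar>"
      unfolding k by (intro exI[of _ p] allI impI m m_le)
  qed
  moreover have "range (\<lambda>n. x (s n)) \<subseteq> V"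
    using x by auto
  ultimately obtain l v
    where l: "l \<in> V" and v: "v \<in> V" and lim: "r_converges (\<lambda>n. x (s n)) l v"
    using V u unfolding ucvl_def by blast
  define w where "w = sup u (- u) + sup v (- v)"
  have w: "w = \<bar>u\<bar> + \<bar>v\<bar>" by (simp add: w_def abs_lattice)
  have sub: "subspace V" and sup: "\<And>a b. a \<in> V \<Longrightarrow> b \<in> V \<Longrightarrow> sup a b \<in> V"
    using V by (auto simp: ucvl_def vector_sublattice_def)
  have wV: "w \<in> V"
    unfolding w_def by (intro subspace_add[OF sub] sup u v subspace_neg[OF sub])
  have "r_converges x l w"
    unfolding r_converges_def
  proof (intro allI impI)
    fix k :: nat assume k1: "k \<ge> 1"
    then obtain p where k: "k = Suc p" by (cases k) auto
    obtain n0 where n0: "\<And>n. n \<ge> n0 \<Longrightarrow> \<bar>x (s n) - l\<bar> \<le> (1 / real k) *\<^sub>R \<bar>v\<bar>"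
      using lim k1 unfolding r_converges_def by blast
    define n where "n = max n0 p"
    have "\<bar>x i - l\<bar> \<le> (1 / real k) *\<^sub>R \<bar>w\<bar>" if "m p \<le> i" for i
    proof -
      have "\<bar>x i - l\<bar> \<le> \<bar>x i - x (s n)\<bar> + \<bar>x (s n) - l\<bar>"
        using abs_triangle_ineq[of "x i - x (s n)" "x (s n) - l"] by simp
      also have "\<dots> \<le> (1 / real k) *\<^sub>R \<bar>u\<bar> + (1 / real k) *\<^sub>R \<bar>v\<bar>"
        using m[OF that m_le[of p n]] n0[of n] by (intro add_mono) (auto simp: n_def k)
      also have "\<dots> = (1 / real k) *\<^sub>R \<bar>w\<bar>"
        by (simp add: w scaleR_add_right)
      finally show ?thesis .
    qed
    then show "\<exists>m. \<forall>i\<ge>m. \<bar>x i - l\<bar> \<le> (1 / real k) *\<^sub>R \<bar>w\<bar>" by blast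
  qed
  with l wV show ?thesis by blast
qed

lemma ucvl_fun_UNIV: "ucvl (UNIV :: ('b \<Rightarrow> real) set)"
  unfolding ucvl_def
proof (intro conjI ballI allI impI)
  show "vector_sublattice (UNIV :: ('b \<Rightarrow> real) set)"
    by (simp add: vector_sublattice_def)
  show "archimedean_on (UNIV :: ('b \<Rightarrow> real) set)"
    unfolding archimedean_on_def
  proof (intro ballI impI ext, elim conjE)
    fix x y :: "'b \<Rightarrow> real" and b
    assume "0 \<le> x" and le: "\<forall>n. real n *\<^sub>R x \<le> y"
    then have "0 \<le> x b" and n: "\<And>n. real n * x b \<le> y b"
      by (auto simp: le_fun_def scaleR_fun_def)
    moreover have "\<not> 0 < x b"
    proof
      assume "0 < x b"
      then obtain n where "y b < real n * x b"
        using reals_Archimedean3 by blast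
      with n[of n] show False by simp
    qed
    ultimately show "x b = 0 b" by simp
  qed
next
  fix u :: "'b \<Rightarrow> real" and x :: "nat \<Rightarrow> 'b \<Rightarrow> real"
  assume "range x \<subseteq> UNIV \<and> r_Cauchy x u"
  then have cauchy: "\<exists>m. \<forall>i\<ge>m. \<forall>j\<ge>m. \<forall>b. \<bar>x i b - x j b\<bar> \<le> \<bar>u b\<bar> / real k" if "k \<ge> 1" for k
    using that by (simp add: r_Cauchy_def le_fun_def abs_fun_def scaleR_fun_def)
  have "Cauchy (\<lambda>n. x n b)" for b
  proof (rule CauchyI)
    fix e :: real assume "0 < e"
    then obtain k where k: "\<bar>u b\<bar> < real k * e"
      using reals_Archimedean3 by blast
    with \<open>0 < e\<close> have k1: "k \<ge> 1"
      by (cases k) auto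
    with k have "\<bar>u b\<bar> / real k < e"
      by (simp add: field_simps)
    moreover obtain M where "\<forall>i\<ge>M. \<forall>j\<ge>M. \<forall>b. \<bar>x i b - x j b\<bar> \<le> \<bar>u b\<bar> / real k"
      using cauchy[OF k1] by blast
    ultimately have "\<forall>m\<ge>M. \<forall>n\<ge>M. norm (x m b - x n b) < e"
      by (simp add: le_less_trans[of _ "\<bar>u b\<bar> / real k" e])
    then show "\<exists>M. \<forall>m\<ge>M. \<forall>n\<ge>M. norm (x m b - x n b) < e" ..
  qed
  then have l: "(\<lambda>n. x n b) \<longlonglongrightarrow> lim (\<lambda>n. x n b)" for b
    by (simp add: Cauchy_convergent_iff convergent_LIMSEQ_iff)
  define l where "l = (\<lambda>b. lim (\<lambda>n. x n b))"
  from l have l: "(\<lambda>n. x n b) \<longlonglongrightarrow> l b" for b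
    by (simp add: l_def)
  have "r_converges x l u"
    unfolding r_converges_def
  proof (intro allI impI)
    fix k :: nat assume "k \<ge> 1"
    then obtain m where m: "\<And>i j b. i \<ge> m \<Longrightarrow> j \<ge> m \<Longrightarrow> \<bar>x i b - x j b\<bar> \<le> \<bar>u b\<bar> / real k"
      using cauchy[OF \<open>k \<ge> 1\<close>] by blast
    have "\<bar>x i b - l b\<bar> \<le> \<bar>u b\<bar> / real k" if "i \<ge> m" for i b
    proof (rule LIMSEQ_le_const2)
      show "(\<lambda>j. \<bar>x i b - x j b\<bar>) \<longlonglongrightarrow> \<bar>x i b - l b\<bar>"
        by (intro tendsto_intros l)
      show "\<exists>N. \<forall>j\<ge>N. \<bar>x i b - x j b\<bar> \<le> \<bar>u b\<bar> / real k"
        using m[OF that] by blast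
    qed
    then show "\<exists>m. \<forall>i\<ge>m. \<bar>x i - l\<bar> \<le> (1 / real k) *\<^sub>R \<bar>u\<bar>"
      by (auto simp: le_fun_def abs_fun_def scaleR_fun_def)
  qed
  then show "\<exists>l\<in>UNIV. \<exists>v\<in>UNIV. r_converges x l v" by blast
qed


section \<open>Free uniformly complete vector lattices\<close>

text \<open>
  The set \<open>A\<close> of generators is the (necessarily non-empty) type \<open>'a\<close>. The type token
  \<open>'e\<close> is the type in which the competing \<open>E\<close> live; theorems are to be stated for arbitrary \<open>'e\<close>.
  Homomorphisms are taken in \<open>F \<rightarrow>\<^sub>E E\<close> so that \<open>\<exists>!\<close> means uniqueness as a map on \<open>F\<close>.
\<close>

definition free_ucvl ::
    "'e::vector_lattice itself \<Rightarrow> 'f::vector_lattice set \<Rightarrow> ('a \<Rightarrow> 'f) \<Rightarrow> bool"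
  where "free_ucvl TYPE('e) F f \<longleftrightarrow>
    ucvl F \<and> range f \<subseteq> F \<and> inj f \<and>
    (\<forall>(E::'e set) (q::'a \<Rightarrow> 'e). ucvl E \<and> range q \<subseteq> E \<and> inj q \<longrightarrow>
      (\<exists>!T. T \<in> F \<rightarrow>\<^sub>E E \<and> riesz_hom_on F T \<and> (\<forall>a. q a = T (f a))))"

definition point_eval :: "'a \<Rightarrow> ('a \<Rightarrow> real) \<Rightarrow> real"
  where "point_eval a \<xi> = \<xi> a"

end

theory Submission
  imports Defs "HOL-Analysis.Product_Vector" "HOL-Library.Product_Order"
begin

text \<open>
  Uniqueness is a density argument. Two Riesz homomorphisms on \<open>F\<close> with values in an
  Archimedean vector lattice agree on a sublattice that is itself uniformly complete
  (\<open>ucvl_equalizer\<close>); if they agree on the point evaluations, this sublattice is all of \<open>F\<close>,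
  because \<open>F\<close> is the least one. That \<open>F\<close> is uniformly complete rests on the uniqueness of
  relative uniform limits: all the sublattices that are intersected receive the same limit, with
  a regulator taken from the intersection (\<open>ucvl_Inter\<close>).

  For existence, let \<open>q\<close> map the generators into \<open>E\<close>. Homomorphisms from sublattices of the function
  lattice to \<open>E\<close> are handled through their graphs, which are vector sublattices \<open>H\<close> of the product
  with \<open>(0, y) \<in> H\<close> only for \<open>y = 0\<close>. Such a graph is automatically monotone, as
  \<open>sup (z - z') 0\<close> detects whether \<open>z \<le> z'\<close> in either coordinate.

  The point evaluations are linearly independent, so \<open>\<delta>\<^sub>a \<mapsto> q a\<close> extends to a linear map on their
  span. To pass from the linear to the lattice span one has to see that an inequality
  \<open>p \<le> sup q\<^sub>1 \<dots> q\<^sub>n\<close> between functions in the span persists in \<open>E\<close>. The inequality says that at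
  every point one of the linear functionals \<open>q\<^sub>i - p\<close> is nonnegative. By Gordan's theorem of
  the alternative (\<open>gordan_alternative\<close>) some convex combination of them vanishes identically.
  Thus \<open>p\<close> is a convex combination of the \<open>q\<^sub>i\<close>, which is a linear relation that the linear map
  carries to \<open>E\<close>, and there it implies the inequality.

  Finally, adding to a graph all its relative uniform limits gives a graph again, by monotonicity
  and the Archimedean property of \<open>E\<close> (\<open>lattice_graph_r_adherence\<close>). A graph that is maximal among
  those above the given one, supplied by Zorn's lemma, therefore contains its limits; as
  \<open>E\<close> is uniformly complete, so is the domain of such a graph (\<open>lattice_graph_extension\<close>), and the
  domain includes \<open>F\<close> by minimality of \<open>F\<close>.
\<close>

section \<open>Calculus in vector lattices\<close>

lemma scaleR_sup_distrib:
  fixes a b :: "'v::vector_lattice"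
  assumes "0 \<le> c"
  shows "c *\<^sub>R sup a b = sup (c *\<^sub>R a) (c *\<^sub>R b)"
proof (cases "c = 0")
  case False
  with assms have c: "0 < c" by simp
  have "a = (1 / c) *\<^sub>R (c *\<^sub>R a)" "b = (1 / c) *\<^sub>R (c *\<^sub>R b)"
    using c by simp_all
  moreover have "(1 / c) *\<^sub>R (c *\<^sub>R a) \<le> (1 / c) *\<^sub>R sup (c *\<^sub>R a) (c *\<^sub>R b)"
    "(1 / c) *\<^sub>R (c *\<^sub>R b) \<le> (1 / c) *\<^sub>R sup (c *\<^sub>R a) (c *\<^sub>R b)"
    using c by (intro scaleR_left_mono; simp)+
  ultimately have "sup a b \<le> (1 / c) *\<^sub>R sup (c *\<^sub>R a) (c *\<^sub>R b)" by simp
  then have "c *\<^sub>R sup a b \<le> c *\<^sub>R ((1 / c) *\<^sub>R sup (c *\<^sub>R a) (c *\<^sub>R b))"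
    using assms by (rule scaleR_left_mono)
  then show ?thesis
    using c by (intro antisym) (auto intro: scaleR_left_mono)
qed simp

lemma abs_scaleR_vector_lattice:
  fixes x :: "'v::vector_lattice"
  shows "\<bar>c *\<^sub>R x\<bar> = \<bar>c\<bar> *\<^sub>R \<bar>x\<bar>"
proof -
  have *: "\<bar>d *\<^sub>R x\<bar> = d *\<^sub>R \<bar>x\<bar>" if "0 \<le> d" for d
    using that by (simp add: abs_lattice scaleR_sup_distrib)
  show ?thesis
  proof (cases "0 \<le> c")
    case False
    then show ?thesis using *[of "- c"] by simp
  qed (simp add: *)
qed

text \<open>
  Birkhoff's inequality: the modulus is subadditive, so \<open>a\<close> and \<open>b\<close> lie below
  \<open>sup c d\<close> plus the two displacements.
\<close>

lemma abs_sup_diff_le: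
  fixes a b c d :: "'v::vector_lattice"
  shows "\<bar>sup a b - sup c d\<bar> \<le> \<bar>a - c\<bar> + \<bar>b - d\<bar>"
proof -
  have half: "sup a b - sup c d \<le> \<bar>a - c\<bar> + \<bar>b - d\<bar>" for a b c d :: 'v
  proof -
    have "a \<le> sup c d + (\<bar>a - c\<bar> + \<bar>b - d\<bar>)"
    proof -
      have "a = c + ((a - c) + 0)" by simp
      also have "\<dots> \<le> sup c d + (\<bar>a - c\<bar> + \<bar>b - d\<bar>)"
        by (intro add_mono) (auto simp: abs_ge_self)
      finally show ?thesis .
    qed
    moreover have "b \<le> sup c d + (\<bar>a - c\<bar> + \<bar>b - d\<bar>)"
    proof -
      have "b = d + (0 + (b - d))" by simp
      also have "\<dots> \<le> sup c d + (\<bar>a - c\<bar> + \<bar>b - d\<bar>)"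
        by (intro add_mono) (auto simp: abs_ge_self)
      finally show ?thesis .
    qed
    ultimately have "sup a b \<le> sup c d + (\<bar>a - c\<bar> + \<bar>b - d\<bar>)" by simp
    then show ?thesis by (metis add.commute diff_le_eq)
  qed
  show ?thesis
  proof (rule abs_leI)
    show "- (sup a b - sup c d) \<le> \<bar>a - c\<bar> + \<bar>b - d\<bar>"
      using half[of c d a b] by (metis abs_minus_commute minus_diff_eq)
  qed (rule half)
qed

lemma vector_sublatticeI:
  assumes "subspace V" "\<And>x y. x \<in> V \<Longrightarrow> y \<in> V \<Longrightarrow> sup x y \<in> V"
  shows "vector_sublattice V"
proof -
  have "- sup (- x) (- y) \<in> V" if "x \<in> V" "y \<in> V" for x y
    using assms that by (blast intro: subspace_neg)
  then have "inf x y \<in> V" if "x \<in> V" "y \<in> V" for x y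
    using that by (metis inf_eq_neg_sup)
  with assms show ?thesis by (simp add: vector_sublattice_def)
qed

lemma
  assumes "vector_sublattice V"
  shows vector_sublattice_subspace: "subspace V"
    and vector_sublattice_0: "0 \<in> V"
    and vector_sublattice_sup: "x \<in> V \<Longrightarrow> y \<in> V \<Longrightarrow> sup x y \<in> V"
    and vector_sublattice_inf: "x \<in> V \<Longrightarrow> y \<in> V \<Longrightarrow> inf x y \<in> V"
    and vector_sublattice_add: "x \<in> V \<Longrightarrow> y \<in> V \<Longrightarrow> x + y \<in> V"
    and vector_sublattice_diff: "x \<in> V \<Longrightarrow> y \<in> V \<Longrightarrow> x - y \<in> V"
    and vector_sublattice_scaleR: "x \<in> V \<Longrightarrow> c *\<^sub>R x \<in> V"
    and vector_sublattice_abs: "x \<in> V \<Longrightarrow> \<bar>x\<bar> \<in> V"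
  using assms
  by (auto simp: vector_sublattice_def abs_lattice
      intro: subspace_0 subspace_add subspace_diff subspace_scale subspace_neg)

lemmas vector_sublattice_closed =
  vector_sublattice_0 vector_sublattice_sup vector_sublattice_inf vector_sublattice_add
  vector_sublattice_diff vector_sublattice_scaleR vector_sublattice_abs

lemma vector_sublattice_Inter:
  assumes "\<And>V. V \<in> \<V> \<Longrightarrow> vector_sublattice V"
  shows "vector_sublattice (\<Inter>\<V>)"
  using assms by (auto simp: vector_sublattice_def intro!: subspace_Inter)

lemma vector_sublattice_Int:
  "vector_sublattice V \<Longrightarrow> vector_sublattice W \<Longrightarrow> vector_sublattice (V \<inter> W)"
  using vector_sublattice_Inter[of "{V, W}"] by auto

lemma archimedean_on_subset: "archimedean_on V \<Longrightarrow> W \<subseteq> V \<Longrightarrow> archimedean_on W"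
  by (auto simp: archimedean_on_def)

lemma archimedean_on_le:
  assumes V: "vector_sublattice V" "archimedean_on V"
    and mem: "x \<in> V" "y \<in> V" "z \<in> V" and "0 \<le> z"
    and le: "\<And>n::nat. n \<ge> 1 \<Longrightarrow> x \<le> y + (1 / real n) *\<^sub>R z"
  shows "x \<le> y"
proof -
  \<comment> \<open>the positive part of \<open>x - y\<close> is an infinitesimal relative to \<open>z\<close>\<close>
  let ?d = "sup (x - y) 0"
  have "real n *\<^sub>R ?d \<le> z" for n :: nat
  proof (cases "n = 0")
    case False
    then have "x - y \<le> (1 / real n) *\<^sub>R z"
      using le[of n] by (simp add: algebra_simps)
    moreover have "0 \<le> (1 / real n) *\<^sub>R z"
      using \<open>0 \<le> z\<close> by (intro scaleR_nonneg_nonneg) auto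
    ultimately have "?d \<le> (1 / real n) *\<^sub>R z" by simp
    then have "real n *\<^sub>R ?d \<le> real n *\<^sub>R ((1 / real n) *\<^sub>R z)"
      by (rule scaleR_left_mono) simp
    with False show ?thesis by simp
  qed (simp add: \<open>0 \<le> z\<close>)
  moreover have "?d \<in> V" "0 \<le> ?d"
    using mem by (auto intro!: vector_sublattice_closed[OF V(1)])
  ultimately have "?d = 0"
    using V(2) \<open>z \<in> V\<close> unfolding archimedean_on_def by blast
  then have "x - y \<le> 0" by (metis sup_ge1)
  then show ?thesis by simp
qed


section \<open>Relative uniform limits of sequences\<close>

lemma r_converges_const: "r_converges (\<lambda>_. x) x u"
  by (simp add: r_converges_def scaleR_nonneg_nonneg)

lemma r_converges_unique:
  fixes s :: "nat \<Rightarrow> 'v::vector_lattice"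
  assumes V: "vector_sublattice V" "archimedean_on V"
    and mem: "l \<in> V" "l' \<in> V" "u \<in> V" "u' \<in> V"
    and "r_converges s l u" "r_converges s l' u'"
  shows "l = l'"
proof -
  have "\<bar>l - l'\<bar> \<le> 0 + (1 / real n) *\<^sub>R (\<bar>u\<bar> + \<bar>u'\<bar>)" if n: "n \<ge> 1" for n
  proof -
    obtain m m' where
      "\<forall>i\<ge>m. \<bar>s i - l\<bar> \<le> (1 / real n) *\<^sub>R \<bar>u\<bar>" "\<forall>i\<ge>m'. \<bar>s i - l'\<bar> \<le> (1 / real n) *\<^sub>R \<bar>u'\<bar>"
      using assms(7,8) n unfolding r_converges_def by blast
    then have near: "\<bar>s (max m m') - l\<bar> \<le> (1 / real n) *\<^sub>R \<bar>u\<bar>"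
      "\<bar>s (max m m') - l'\<bar> \<le> (1 / real n) *\<^sub>R \<bar>u'\<bar>"
      by auto
    have "\<bar>l - l'\<bar> \<le> \<bar>s (max m m') - l\<bar> + \<bar>s (max m m') - l'\<bar>"
      using abs_triangle_ineq4[of "s (max m m') - l'" "s (max m m') - l"]
      by (simp add: add.commute)
    also have "\<dots> \<le> (1 / real n) *\<^sub>R \<bar>u\<bar> + (1 / real n) *\<^sub>R \<bar>u'\<bar>"
      using near by (rule add_mono)
    finally show ?thesis by (simp only: scaleR_add_right add_0)
  qed
  then have "\<bar>l - l'\<bar> \<le> 0"
    by (rule archimedean_on_le[OF V, where z = "\<bar>u\<bar> + \<bar>u'\<bar>", rotated 4])
      (use mem in \<open>auto intro!: vector_sublattice_closed[OF V(1)]\<close>)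
  then show ?thesis by simp
qed

text \<open>
  Every regulator of the Cauchy property serves for the convergence: the regulator of the
  convergence only enters through terms that the Archimedean property removes.
\<close>

lemma ucvl_r_Cauchy_converges:
  fixes s :: "nat \<Rightarrow> 'v::vector_lattice"
  assumes V: "ucvl V" and s: "range s \<subseteq> V" and u: "u \<in> V" and cauchy: "r_Cauchy s u"
  shows "\<exists>l\<in>V. r_converges s l u"
proof -
  have sub: "vector_sublattice V" and arch: "archimedean_on V"
    using V by (auto simp: ucvl_def)
  obtain l v where l: "l \<in> V" and v: "v \<in> V" and lim: "r_converges s l v"
    using assms unfolding ucvl_def by blast
  have "r_converges s l u"
    unfolding r_converges_def
  proof (intro allI impI)
    fix k :: nat assume "k \<ge> 1"
    then obtain m where
      m: "\<And>i j. i \<ge> m \<Longrightarrow> j \<ge> m \<Longrightarrow> \<bar>s i - s j\<bar> \<le> (1 / real k) *\<^sub>R \<bar>u\<bar>"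
      using cauchy unfolding r_Cauchy_def by blast
    have "\<bar>s i - l\<bar> \<le> (1 / real k) *\<^sub>R \<bar>u\<bar>" if "i \<ge> m" for i
    proof (rule archimedean_on_le[OF sub arch, where z = "\<bar>v\<bar>"])
      fix n :: nat assume "n \<ge> 1"
      then obtain m' where m': "\<And>j. j \<ge> m' \<Longrightarrow> \<bar>s j - l\<bar> \<le> (1 / real n) *\<^sub>R \<bar>v\<bar>"
        using lim unfolding r_converges_def by blast
      let ?j = "max m m'"
      have "\<bar>s i - l\<bar> \<le> \<bar>s i - s ?j\<bar> + \<bar>s ?j - l\<bar>"
        using abs_triangle_ineq[of "s i - s ?j" "s ?j - l"] by simp
      also have "\<dots> \<le> (1 / real k) *\<^sub>R \<bar>u\<bar> + (1 / real n) *\<^sub>R \<bar>v\<bar>"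
        using that by (intro add_mono m m') auto
      finally show "\<bar>s i - l\<bar> \<le> (1 / real k) *\<^sub>R \<bar>u\<bar> + (1 / real n) *\<^sub>R \<bar>v\<bar>" .
    qed (use s u v l in \<open>auto intro!: vector_sublattice_closed[OF sub]\<close>)
    then show "\<exists>m. \<forall>i\<ge>m. \<bar>s i - l\<bar> \<le> (1 / real k) *\<^sub>R \<bar>u\<bar>" by blast
  qed
  with l show ?thesis by blast
qed

text \<open>
  One estimate that covers both \<open>+\<close> and \<open>sup\<close>, each of which moves by at most the sum of the
  displacements of its arguments.
\<close>

lemma r_converges_combine:
  fixes s t r :: "nat \<Rightarrow> 'v::vector_lattice"
  assumes "r_converges s x u" "r_converges t y v"
    and le: "\<And>i. \<bar>r i - z\<bar> \<le> \<bar>s i - x\<bar> + \<bar>t i - y\<bar>"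
  shows "r_converges r z (\<bar>u\<bar> + \<bar>v\<bar>)"
  unfolding r_converges_def
proof (intro allI impI)
  fix k :: nat assume "k \<ge> 1"
  then obtain m m' where
    m: "\<And>i. i\<ge>m \<Longrightarrow> \<bar>s i - x\<bar> \<le> (1 / real k) *\<^sub>R \<bar>u\<bar>" and
    m': "\<And>i. i\<ge>m' \<Longrightarrow> \<bar>t i - y\<bar> \<le> (1 / real k) *\<^sub>R \<bar>v\<bar>"
    using assms(1,2) unfolding r_converges_def by meson
  have "\<bar>r i - z\<bar> \<le> (1 / real k) *\<^sub>R \<bar>\<bar>u\<bar> + \<bar>v\<bar>\<bar>" if "i \<ge> max m m'" for i
  proof -
    note le[of i]
    also have "\<bar>s i - x\<bar> + \<bar>t i - y\<bar> \<le> (1 / real k) *\<^sub>R \<bar>u\<bar> + (1 / real k) *\<^sub>R \<bar>v\<bar>"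
      using that by (intro add_mono m m') auto
    finally show ?thesis by (simp add: scaleR_add_right)
  qed
  then show "\<exists>m. \<forall>i\<ge>m. \<bar>r i - z\<bar> \<le> (1 / real k) *\<^sub>R \<bar>\<bar>u\<bar> + \<bar>v\<bar>\<bar>" by blast
qed

lemma r_converges_scaleR:
  assumes "r_converges s x u"
  shows "r_converges (\<lambda>i. c *\<^sub>R s i) (c *\<^sub>R x) (c *\<^sub>R u)"
  unfolding r_converges_def
proof (intro allI impI)
  fix k :: nat assume "k \<ge> 1"
  then obtain m where m: "\<forall>i\<ge>m. \<bar>s i - x\<bar> \<le> (1 / real k) *\<^sub>R \<bar>u\<bar>"
    using assms unfolding r_converges_def by blast
  have "\<bar>c *\<^sub>R s i - c *\<^sub>R x\<bar> \<le> (1 / real k) *\<^sub>R \<bar>c *\<^sub>R u\<bar>" if "i \<ge> m" for i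
  proof -
    have "\<bar>c\<bar> *\<^sub>R \<bar>s i - x\<bar> \<le> \<bar>c\<bar> *\<^sub>R ((1 / real k) *\<^sub>R \<bar>u\<bar>)"
      using m that by (intro scaleR_left_mono) auto
    then show ?thesis
      by (simp add: abs_scaleR_vector_lattice mult.commute flip: scaleR_diff_right)
  qed
  then show "\<exists>m. \<forall>i\<ge>m. \<bar>c *\<^sub>R s i - c *\<^sub>R x\<bar> \<le> (1 / real k) *\<^sub>R \<bar>c *\<^sub>R u\<bar>" by blast
qed

text \<open>
  Uniform completeness of the ambient lattice makes the limit in each member the limit there, so
  all members contain the same limit; \<open>u\<close> itself is a regulator common to all of them.
\<close>

lemma ucvl_Inter:
  fixes \<V> :: "'v::vector_lattice set set"
  assumes U: "ucvl (UNIV :: 'v set)" and \<V>: "\<And>V. V \<in> \<V> \<Longrightarrow> ucvl V"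
  shows "ucvl (\<Inter>\<V>)"
  unfolding ucvl_def
proof (intro conjI ballI allI impI)
  show "vector_sublattice (\<Inter>\<V>)"
    using \<V> by (intro vector_sublattice_Inter) (auto simp: ucvl_def)
  have U': "vector_sublattice (UNIV :: 'v set)" "archimedean_on (UNIV :: 'v set)"
    using U by (auto simp: ucvl_def)
  then show "archimedean_on (\<Inter>\<V>)"
    by (auto intro: archimedean_on_subset)
  fix u and s :: "nat \<Rightarrow> 'v"
  assume u: "u \<in> \<Inter>\<V>" and s: "range s \<subseteq> \<Inter>\<V> \<and> r_Cauchy s u"
  obtain l where l: "r_converges s l u"
    using ucvl_r_Cauchy_converges[OF U, of s u] s by auto
  have "l \<in> V" if V: "V \<in> \<V>" for V
  proof -
    obtain l' where "l' \<in> V" "r_converges s l' u"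
      using ucvl_r_Cauchy_converges[OF \<V>[OF V], of s u] s u V by auto
    then show ?thesis
      using r_converges_unique[OF U' _ _ _ _ l, of l' u] by auto
  qed
  with l u show "\<exists>l\<in>\<Inter>\<V>. \<exists>v\<in>\<Inter>\<V>. r_converges s l v" by blast
qed


section \<open>Riesz homomorphisms and uniqueness\<close>

lemma riesz_hom_on_0: "vector_sublattice V \<Longrightarrow> riesz_hom_on V T \<Longrightarrow> T 0 = 0"
  by (metis riesz_hom_on_def scaleR_zero_left vector_sublattice_0)

lemma riesz_hom_on_abs:
  assumes "vector_sublattice V" "riesz_hom_on V T" "x \<in> V"
  shows "T \<bar>x\<bar> = \<bar>T x\<bar>"
proof -
  have "T (sup x (- 1 *\<^sub>R x)) = sup (T x) (- 1 *\<^sub>R T x)"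
    using assms vector_sublattice_scaleR[OF assms(1), of x "- 1"]
    unfolding riesz_hom_on_def by metis
  then show ?thesis by (simp add: abs_lattice)
qed

lemma riesz_hom_on_diff:
  assumes "vector_sublattice V" "riesz_hom_on V T" "x \<in> V" "y \<in> V"
  shows "T (x - y) = T x - T y"
proof -
  have "T (x + - 1 *\<^sub>R y) = T x + - 1 *\<^sub>R T y"
    using assms vector_sublattice_scaleR[OF assms(1), of y "- 1"]
    unfolding riesz_hom_on_def by metis
  then show ?thesis by simp
qed

lemma riesz_hom_on_mono:
  assumes "riesz_hom_on V T" "x \<in> V" "y \<in> V" "x \<le> y"
  shows "T x \<le> T y"
  using assms unfolding riesz_hom_on_def by (metis sup.absorb_iff2)

lemma riesz_hom_on_r_converges:
  assumes V: "vector_sublattice V" and T: "riesz_hom_on V T"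
    and mem: "range s \<subseteq> V" "x \<in> V" "u \<in> V" and lim: "r_converges s x u"
  shows "r_converges (\<lambda>i. T (s i)) (T x) (T u)"
  unfolding r_converges_def
proof (intro allI impI)
  fix k :: nat assume "k \<ge> 1"
  then obtain m where m: "\<And>i. i \<ge> m \<Longrightarrow> \<bar>s i - x\<bar> \<le> (1 / real k) *\<^sub>R \<bar>u\<bar>"
    using lim unfolding r_converges_def by blast
  have "\<bar>T (s i) - T x\<bar> \<le> (1 / real k) *\<^sub>R \<bar>T u\<bar>" if "i \<ge> m" for i
  proof -
    have si: "s i \<in> V" using mem by auto
    have "T \<bar>s i - x\<bar> \<le> T ((1 / real k) *\<^sub>R \<bar>u\<bar>)"
      using si mem m[OF that]
      by (intro riesz_hom_on_mono[OF T]) (auto intro!: vector_sublattice_closed[OF V])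
    moreover have "T \<bar>s i - x\<bar> = \<bar>T (s i) - T x\<bar>"
      using si mem by (simp add: riesz_hom_on_abs[OF V T] riesz_hom_on_diff[OF V T]
          vector_sublattice_diff[OF V])
    moreover have "T ((1 / real k) *\<^sub>R \<bar>u\<bar>) = (1 / real k) *\<^sub>R \<bar>T u\<bar>"
      using T vector_sublattice_abs[OF V \<open>u \<in> V\<close>] riesz_hom_on_abs[OF V T \<open>u \<in> V\<close>]
      unfolding riesz_hom_on_def by auto
    ultimately show ?thesis by simp
  qed
  then show "\<exists>m. \<forall>i\<ge>m. \<bar>T (s i) - T x\<bar> \<le> (1 / real k) *\<^sub>R \<bar>T u\<bar>" by blast
qed

text \<open>
  Two Riesz homomorphisms into an Archimedean target send a limit of points at which they
  agree to limits of one and the same sequence.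
\<close>

lemma ucvl_equalizer:
  assumes F: "ucvl F" and E: "vector_sublattice E" "archimedean_on E"
    and T: "riesz_hom_on F T" "T ` F \<subseteq> E" and S: "riesz_hom_on F S" "S ` F \<subseteq> E"
  shows "ucvl {x \<in> F. T x = S x}"
  unfolding ucvl_def
proof (intro conjI ballI allI impI)
  have F': "vector_sublattice F" "archimedean_on F"
    using F by (auto simp: ucvl_def)
  show "vector_sublattice {x \<in> F. T x = S x}"
  proof (rule vector_sublatticeI)
    show "subspace {x \<in> F. T x = S x}"
      using T(1) S(1) riesz_hom_on_0[OF F'(1) T(1)] riesz_hom_on_0[OF F'(1) S(1)]
      unfolding subspace_def riesz_hom_on_def
      by (auto intro: vector_sublattice_closed[OF F'(1)])
    show "sup x y \<in> {x \<in> F. T x = S x}"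
      if "x \<in> {x \<in> F. T x = S x}" "y \<in> {x \<in> F. T x = S x}" for x y
      using that T(1) S(1) unfolding riesz_hom_on_def
      by (auto intro: vector_sublattice_closed[OF F'(1)])
  qed
  show "archimedean_on {x \<in> F. T x = S x}"
    by (rule archimedean_on_subset[OF F'(2)]) auto
  fix u and s :: "nat \<Rightarrow> 'a"
  assume u: "u \<in> {x \<in> F. T x = S x}"
    and s: "range s \<subseteq> {x \<in> F. T x = S x} \<and> r_Cauchy s u"
  then have uF: "u \<in> F" and sF: "range s \<subseteq> F" by auto
  obtain l where l: "l \<in> F" "r_converges s l u"
    using ucvl_r_Cauchy_converges[OF F sF uF] s by auto
  have "(\<lambda>i. T (s i)) = (\<lambda>i. S (s i))" using s by auto
  then have "r_converges (\<lambda>i. T (s i)) (T l) (T u)" "r_converges (\<lambda>i. T (s i)) (S l) (S u)"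
    using riesz_hom_on_r_converges[OF F'(1) T(1) sF l(1) uF l(2)]
      riesz_hom_on_r_converges[OF F'(1) S(1) sF l(1) uF l(2)] by simp_all
  then have "T l = S l"
    using T(2) S(2) l(1) uF by (intro r_converges_unique[OF E]) auto
  with l u show "\<exists>l\<in>{x \<in> F. T x = S x}. \<exists>v\<in>{x \<in> F. T x = S x}. r_converges s l v"
    by blast
qed


section \<open>Products of vector lattices and graphs\<close>

instantiation prod :: (vector_lattice, vector_lattice) vector_lattice
begin

definition abs_prod :: "'a \<times> 'b \<Rightarrow> 'a \<times> 'b"
  where "abs_prod z = (\<bar>fst z\<bar>, \<bar>snd z\<bar>)"

instance
  by standard
    (auto simp: abs_prod_def less_eq_prod_def abs_lattice prod_eq_iff
      intro: scaleR_left_mono scaleR_right_mono)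

end

lemma fst_abs [simp]: "fst \<bar>z\<bar> = \<bar>fst z\<bar>" and snd_abs [simp]: "snd \<bar>z\<bar> = \<bar>snd z\<bar>"
  by (simp_all add: abs_prod_def)

lemma vector_sublattice_UNIV_Times:
  assumes "vector_sublattice E"
  shows "vector_sublattice (UNIV \<times> E)"
  using assms by (auto simp: vector_sublattice_def subspace_def mem_Times_iff)

lemma r_converges_prod_iff:
  fixes s :: "nat \<Rightarrow> 'v::vector_lattice \<times> 'w::vector_lattice"
  shows "r_converges s z u \<longleftrightarrow>
    r_converges (\<lambda>i. fst (s i)) (fst z) (fst u) \<and> r_converges (\<lambda>i. snd (s i)) (snd z) (snd u)"
    (is "?l \<longleftrightarrow> ?r1 \<and> ?r2")
proof
  assume ?l
  then show "?r1 \<and> ?r2"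
    unfolding r_converges_def less_eq_prod_def by simp blast
next
  assume r: "?r1 \<and> ?r2"
  show ?l
    unfolding r_converges_def
  proof (intro allI impI)
    fix k :: nat assume k: "k \<ge> 1"
    obtain m m' where
      "\<forall>i\<ge>m. \<bar>fst (s i) - fst z\<bar> \<le> (1 / real k) *\<^sub>R \<bar>fst u\<bar>"
      "\<forall>i\<ge>m'. \<bar>snd (s i) - snd z\<bar> \<le> (1 / real k) *\<^sub>R \<bar>snd u\<bar>"
      using r k unfolding r_converges_def by blast
    then show "\<exists>m. \<forall>i\<ge>m. \<bar>s i - z\<bar> \<le> (1 / real k) *\<^sub>R \<bar>u\<bar>"
      by (intro exI[of _ "max m m'"]) (simp add: less_eq_prod_def)
  qed
qed

text \<open>
  The graphs of the Riesz homomorphisms into \<open>E\<close> whose domain is a vector sublattice. Extending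
  a homomorphism becomes enlarging a set, to which closure operations and Zorn's lemma apply.
\<close>

definition lattice_graph ::
    "'w::vector_lattice set \<Rightarrow> ('v::vector_lattice \<times> 'w) set \<Rightarrow> bool"
  where "lattice_graph E H \<longleftrightarrow>
    vector_sublattice H \<and> H \<subseteq> UNIV \<times> E \<and> (\<forall>y. (0, y) \<in> H \<longrightarrow> y = 0)"

text \<open>
  The condition at \<open>0\<close> alone yields monotonicity: \<open>sup (z - z') 0\<close> lies in \<open>H\<close> and its first
  coordinate vanishes.
\<close>

lemma lattice_graph_mono:
  assumes "lattice_graph E H" "z \<in> H" "z' \<in> H" "fst z \<le> fst z'"
  shows "snd z \<le> snd z'"
proof -
  have H: "vector_sublattice H" using assms(1) by (simp add: lattice_graph_def)
  have "sup (z - z') 0 \<in> H"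
    using assms by (auto intro!: vector_sublattice_closed[OF H])
  moreover have "fst (sup (z - z') 0) = 0"
    using assms(4) by (simp add: sup.absorb2)
  ultimately have "snd (sup (z - z') 0) = 0"
    using assms(1) unfolding lattice_graph_def by (metis prod.collapse)
  then have "sup (snd z - snd z') 0 = 0" by simp
  then have "snd z - snd z' \<le> 0" by (metis sup_ge1)
  then show ?thesis by simp
qed

lemma lattice_graph_unique:
  assumes "lattice_graph E H" "(x, y) \<in> H" "(x, y') \<in> H"
  shows "y = y'"
  using lattice_graph_mono[OF assms] lattice_graph_mono[OF assms(1,3,2)] by simp

lemma vector_sublattice_fst_image:
  assumes H: "vector_sublattice H"
  shows "vector_sublattice (fst ` H)"
proof (rule vector_sublatticeI)
  show "subspace (fst ` H)"
    unfolding subspace_def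
  proof (intro conjI ballI allI)
    show "0 \<in> fst ` H"
      by (rule image_eqI[OF _ vector_sublattice_0[OF H]]) simp
    show "x + y \<in> fst ` H" if "x \<in> fst ` H" "y \<in> fst ` H" for x y
      using that by (metis (no_types, lifting) H fst_add image_iff vector_sublattice_add)
    show "c *\<^sub>R x \<in> fst ` H" if "x \<in> fst ` H" for c x
      using that by (metis (no_types, lifting) H fst_scaleR image_iff vector_sublattice_scaleR)
  qed
  show "sup x y \<in> fst ` H" if "x \<in> fst ` H" "y \<in> fst ` H" for x y
    using that by (metis (no_types, lifting) H fst_sup image_iff vector_sublattice_sup)
qed

lemma lattice_graph_riesz_hom:
  assumes H: "lattice_graph E H"
  obtains T where "\<And>z. z \<in> H \<Longrightarrow> T (fst z) = snd z" "riesz_hom_on (fst ` H) T"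
    "T ` fst ` H \<subseteq> E"
proof -
  have sub: "vector_sublattice H" using H by (simp add: lattice_graph_def)
  define T where "T x = (THE y. (x, y) \<in> H)" for x
  have T: "T (fst z) = snd z" if "z \<in> H" for z
    unfolding T_def using that by (intro the_equality) (auto intro: lattice_graph_unique[OF H])
  moreover have "riesz_hom_on (fst ` H) T"
    unfolding riesz_hom_on_def
  proof (intro conjI ballI allI)
    fix x y assume "x \<in> fst ` H" "y \<in> fst ` H"
    then obtain z w where zw: "z \<in> H" "w \<in> H" and [simp]: "x = fst z" "y = fst w"
      by auto
    show "T (x + y) = T x + T y" "T (sup x y) = sup (T x) (T y)" "T (inf x y) = inf (T x) (T y)"
      using T[OF vector_sublattice_add[OF sub zw]] T[OF vector_sublattice_sup[OF sub zw]]
        T[OF vector_sublattice_inf[OF sub zw]] T[OF zw(1)] T[OF zw(2)] by simp_all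
  next
    fix c x assume "x \<in> fst ` H"
    then obtain z where z: "z \<in> H" and [simp]: "x = fst z" by auto
    show "T (c *\<^sub>R x) = c *\<^sub>R T x"
      using T[OF vector_sublattice_scaleR[OF sub z]] T[OF z] by simp
  qed
  moreover have "T ` fst ` H \<subseteq> E"
    using H T unfolding lattice_graph_def by fastforce
  ultimately show thesis using that by blast
qed


section \<open>Extension of lattice graphs by relative uniform limits\<close>

text \<open>
  A single round of adding limits, with regulators from \<open>H\<close>; the result need not be closed under
  taking limits again.
\<close>

definition r_adherence :: "'v::vector_lattice set \<Rightarrow> 'v set"
  where "r_adherence H =
    {x. \<exists>(s::nat \<Rightarrow> 'v) u. range s \<subseteq> H \<and> u \<in> H \<and> r_converges s x u}"

lemma r_adherenceI:
  "(\<And>i::nat. s i \<in> H) \<Longrightarrow> u \<in> H \<Longrightarrow> r_converges s x u \<Longrightarrow> x \<in> r_adherence H"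
  unfolding r_adherence_def by (auto intro!: exI[of _ s] exI[of _ u])

lemma r_adherenceE:
  assumes "x \<in> r_adherence H"
  obtains s u where "\<forall>i::nat. s i \<in> H" "u \<in> H" "r_converges s x u"
  using assms unfolding r_adherence_def by (auto simp: image_subset_iff)

lemma r_adherence_superset: "H \<subseteq> r_adherence H"
  by (auto intro: r_adherenceI r_converges_const)

lemma vector_sublattice_r_adherence:
  fixes H :: "'v::vector_lattice set"
  assumes H: "vector_sublattice H"
  shows "vector_sublattice (r_adherence H)"
proof (rule vector_sublatticeI)
  have combine: "f x y \<in> r_adherence H"
    if f: "\<And>a b. a \<in> H \<Longrightarrow> b \<in> H \<Longrightarrow> f a b \<in> H"
      and le: "\<And>a b. \<bar>f a b - f x y\<bar> \<le> \<bar>a - x\<bar> + \<bar>b - y\<bar>"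
      and xy: "x \<in> r_adherence H" "y \<in> r_adherence H"
    for f :: "'v \<Rightarrow> 'v \<Rightarrow> 'v" and x y
  proof -
    obtain s u where s: "\<forall>i::nat. s i \<in> H" "u \<in> H" "r_converges s x u"
      using xy(1) by (rule r_adherenceE)
    obtain t v where t: "\<forall>i::nat. t i \<in> H" "v \<in> H" "r_converges t y v"
      using xy(2) by (rule r_adherenceE)
    have "r_converges (\<lambda>i. f (s i) (t i)) (f x y) (\<bar>u\<bar> + \<bar>v\<bar>)"
      by (rule r_converges_combine[OF s(3) t(3) le])
    moreover have "\<bar>u\<bar> + \<bar>v\<bar> \<in> H"
      using s t by (auto intro!: vector_sublattice_closed[OF H])
    ultimately show ?thesis
      using s(1) t(1) f by (simp add: r_adherenceI[where s = "\<lambda>i. f (s i) (t i)"])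
  qed
  show "subspace (r_adherence H)"
    unfolding subspace_def
  proof (intro conjI ballI allI)
    show "0 \<in> r_adherence H"
      using r_adherence_superset vector_sublattice_0[OF H] by blast
    show "x + y \<in> r_adherence H" if "x \<in> r_adherence H" "y \<in> r_adherence H" for x y
      by (rule combine[where f = "(+)", OF vector_sublattice_add[OF H] _ that])
        (simp_all only: add_diff_add abs_triangle_ineq)
    show "c *\<^sub>R x \<in> r_adherence H" if "x \<in> r_adherence H" for c x
    proof -
      obtain s u where s: "\<forall>i::nat. s i \<in> H" "u \<in> H" "r_converges s x u"
        using \<open>x \<in> r_adherence H\<close> by (rule r_adherenceE)
      have "\<And>i. c *\<^sub>R s i \<in> H" "c *\<^sub>R u \<in> H"
        using s(1,2) by (auto intro: vector_sublattice_scaleR[OF H])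
      then show ?thesis
        using r_converges_scaleR[OF s(3), of c] by (rule r_adherenceI)
    qed
  qed
  show "sup x y \<in> r_adherence H" if "x \<in> r_adherence H" "y \<in> r_adherence H" for x y
    by (rule combine[where f = sup, OF vector_sublattice_sup[OF H] abs_sup_diff_le that])
qed

text \<open>
  If the first coordinates of a sequence in \<open>H\<close> tend to \<open>0\<close>, monotonicity carries the estimates to the
  second coordinates, with the second coordinate of the regulator. So the second coordinates tend
  to \<open>0\<close> as well, and limits in \<open>E\<close> are unique. The intersection with \<open>UNIV \<times> E\<close> discards limits
  that lie in the type of \<open>E\<close> but outside \<open>E\<close>.
\<close>

lemma lattice_graph_r_adherence:
  assumes E: "vector_sublattice E" "archimedean_on E" and H: "lattice_graph E H"
  shows "lattice_graph E (r_adherence H \<inter> UNIV \<times> E)"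
  unfolding lattice_graph_def
proof (intro conjI allI impI)
  have sub: "vector_sublattice H" and HE: "H \<subseteq> UNIV \<times> E"
    using H by (auto simp: lattice_graph_def)
  show "vector_sublattice (r_adherence H \<inter> UNIV \<times> E)"
    using sub E(1) by (intro vector_sublattice_Int vector_sublattice_r_adherence
        vector_sublattice_UNIV_Times)
  show "r_adherence H \<inter> UNIV \<times> E \<subseteq> UNIV \<times> E" by simp
  fix y assume "(0, y) \<in> r_adherence H \<inter> UNIV \<times> E"
  then have y: "y \<in> E" and "(0, y) \<in> r_adherence H" by auto
  from this(2) obtain s u where s: "\<forall>i::nat. s i \<in> H" and u: "u \<in> H" and "r_converges s (0, y) u"
    by (rule r_adherenceE)
  then have lim: "r_converges (\<lambda>i. fst (s i)) 0 (fst u)" "r_converges (\<lambda>i. snd (s i)) y (snd u)"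
    by (simp_all add: r_converges_prod_iff)
  have "r_converges (\<lambda>i. snd (s i)) 0 (snd u)"
    unfolding r_converges_def
  proof (intro allI impI)
    fix k :: nat assume "k \<ge> 1"
    then obtain m where m: "\<And>i. i \<ge> m \<Longrightarrow> \<bar>fst (s i)\<bar> \<le> (1 / real k) *\<^sub>R \<bar>fst u\<bar>"
      using lim(1) unfolding r_converges_def by (metis diff_zero)
    have "snd \<bar>s i\<bar> \<le> snd ((1 / real k) *\<^sub>R \<bar>u\<bar>)" if "i \<ge> m" for i
      using s u m[OF that]
      by (intro lattice_graph_mono[OF H]) (auto intro!: vector_sublattice_closed[OF sub])
    then show "\<exists>m. \<forall>i\<ge>m. \<bar>snd (s i) - 0\<bar> \<le> (1 / real k) *\<^sub>R \<bar>snd u\<bar>" by auto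
  qed
  moreover have "snd u \<in> E" using u HE by auto
  ultimately show "y = 0"
    using lim(2) y vector_sublattice_0[OF E(1)] by (intro r_converges_unique[OF E]) auto
qed

text \<open>
  A Cauchy sequence in the domain lifts to \<open>M\<close>, and by monotonicity the second coordinates of the
  lift are Cauchy too. Both coordinates converge with the two coordinates of one regulator
  \<open>w \<in> M\<close>, by \<open>ucvl_r_Cauchy_converges\<close>, so that the lift converges in the sense of \<open>r_adherence\<close>.
\<close>

lemma ucvl_domain_of_r_closed_lattice_graph:
  fixes M :: "('v::vector_lattice \<times> 'w::vector_lattice) set"
  assumes U: "ucvl (UNIV :: 'v set)" and E: "ucvl E" and M: "lattice_graph E M"
    and closed: "r_adherence M \<inter> UNIV \<times> E \<subseteq> M"
  shows "ucvl (fst ` M)"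
  unfolding ucvl_def
proof (intro conjI ballI allI impI)
  have sub: "vector_sublattice M" and ME: "M \<subseteq> UNIV \<times> E"
    using M by (auto simp: lattice_graph_def)
  show "vector_sublattice (fst ` M)"
    by (rule vector_sublattice_fst_image[OF sub])
  show "archimedean_on (fst ` M)"
    using U by (auto simp: ucvl_def intro: archimedean_on_subset[of UNIV])
  fix u and x :: "nat \<Rightarrow> 'v"
  assume "u \<in> fst ` M" and "range x \<subseteq> fst ` M \<and> r_Cauchy x u"
  then have range_x: "range x \<subseteq> fst ` M" and x: "r_Cauchy x u"
    by simp_all
  obtain w where w: "w \<in> M" "u = fst w" using \<open>u \<in> fst ` M\<close> by auto
  have "\<exists>z\<in>M. x i = fst z" for i using range_x by auto
  then obtain s where s: "\<And>i. s i \<in> M" "\<And>i. x i = fst (s i)" by metis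
  have "r_Cauchy (\<lambda>i. snd (s i)) (snd w)"
    unfolding r_Cauchy_def
  proof (intro allI impI)
    fix k :: nat assume "k \<ge> 1"
    then obtain m where m: "\<And>i j. i \<ge> m \<Longrightarrow> j \<ge> m \<Longrightarrow> \<bar>x i - x j\<bar> \<le> (1 / real k) *\<^sub>R \<bar>u\<bar>"
      using x unfolding r_Cauchy_def by blast
    have "snd \<bar>s i - s j\<bar> \<le> snd ((1 / real k) *\<^sub>R \<bar>w\<bar>)" if "i \<ge> m" "j \<ge> m" for i j
      using m[OF that] s w
      by (intro lattice_graph_mono[OF M]) (auto intro!: vector_sublattice_closed[OF sub])
    then show "\<exists>m. \<forall>i\<ge>m. \<forall>j\<ge>m. \<bar>snd (s i) - snd (s j)\<bar> \<le> (1 / real k) *\<^sub>R \<bar>snd w\<bar>"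
      by auto
  qed
  moreover have snd_in: "snd z \<in> E" if "z \<in> M" for z
    using that ME by auto
  from s(1) w(1) have "range (\<lambda>i. snd (s i)) \<subseteq> E" "snd w \<in> E"
    by (auto intro: snd_in)
  ultimately obtain y where y: "y \<in> E" "r_converges (\<lambda>i. snd (s i)) y (snd w)"
    using ucvl_r_Cauchy_converges[OF E] by blast
  obtain l where l: "r_converges x l u"
    using ucvl_r_Cauchy_converges[OF U, of x u] x by auto
  have "r_converges s (l, y) w"
    using l y(2) w(2) by (simp add: r_converges_prod_iff flip: s(2))
  with s(1) w(1) have "(l, y) \<in> r_adherence M"
    by (rule r_adherenceI)
  with closed y(1) have "(l, y) \<in> M" by auto
  then have "l \<in> fst ` M" by force
  with l show "\<exists>l\<in>fst ` M. \<exists>v\<in>fst ` M. r_converges x l v"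
    using \<open>u \<in> fst ` M\<close> by blast
qed

text \<open>
  Zorn's lemma replaces the transfinite iteration of \<open>r_adherence\<close>: a maximal graph is fixed by it.
\<close>

lemma lattice_graph_extension:
  fixes H :: "('v::vector_lattice \<times> 'w::vector_lattice) set"
  assumes U: "ucvl (UNIV :: 'v set)" and E: "ucvl E" and H: "lattice_graph E H"
  obtains M where "H \<subseteq> M" "lattice_graph E M" "ucvl (fst ` M)"
proof -
  have E': "vector_sublattice E" "archimedean_on E"
    using E by (auto simp: ucvl_def)
  let ?G = "{M. H \<subseteq> M \<and> lattice_graph E M}"
  have "\<exists>M\<in>?G. \<forall>X\<in>?G. M \<subseteq> X \<longrightarrow> X = M"
  proof (rule subset_Zorn_nonempty)
    show "?G \<noteq> {}" using H by blast
    fix C assume ne: "C \<noteq> {}" and C: "subset.chain ?G C"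
    then have graph: "\<And>X. X \<in> C \<Longrightarrow> lattice_graph E X" and sup: "\<And>X. X \<in> C \<Longrightarrow> H \<subseteq> X"
      by (auto simp: subset.chain_def)
    have sub: "\<And>X. X \<in> C \<Longrightarrow> vector_sublattice X"
      using graph by (auto simp: lattice_graph_def)
    have common: "\<exists>X\<in>C. x \<in> X \<and> y \<in> X" if "x \<in> \<Union>C" "y \<in> \<Union>C" for x y
      using that C unfolding subset.chain_def by blast
    have "vector_sublattice (\<Union>C)"
    proof (rule vector_sublatticeI)
      show "subspace (\<Union>C)"
        unfolding subspace_def
      proof (intro conjI ballI allI)
        show "0 \<in> \<Union>C" using ne sub vector_sublattice_0 by blast
        show "x + y \<in> \<Union>C" if "x \<in> \<Union>C" "y \<in> \<Union>C" for x y
          using common[OF that] sub vector_sublattice_add by blast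
        show "c *\<^sub>R x \<in> \<Union>C" if "x \<in> \<Union>C" for c x
          using that sub vector_sublattice_scaleR by blast
      qed
      show "sup x y \<in> \<Union>C" if "x \<in> \<Union>C" "y \<in> \<Union>C" for x y
        using common[OF that] sub vector_sublattice_sup by blast
    qed
    then have "lattice_graph E (\<Union>C)"
      using graph unfolding lattice_graph_def by blast
    with ne sup show "\<Union>C \<in> ?G" by blast
  qed
  then obtain M where "M \<in> ?G" and "\<forall>X\<in>?G. M \<subseteq> X \<longrightarrow> X = M"
    by (rule bexE)
  then have M: "H \<subseteq> M" "lattice_graph E M"
    and max: "\<And>X. H \<subseteq> X \<Longrightarrow> lattice_graph E X \<Longrightarrow> M \<subseteq> X \<Longrightarrow> X = M"
    by simp_all
  have "M \<subseteq> r_adherence M \<inter> UNIV \<times> E"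
    using r_adherence_superset M(2) unfolding lattice_graph_def by blast
  then have "r_adherence M \<inter> UNIV \<times> E = M"
    using M by (intro max lattice_graph_r_adherence[OF E']) auto
  then have "ucvl (fst ` M)"
    by (intro ucvl_domain_of_r_closed_lattice_graph[OF U E M(2)]) simp
  with M that show thesis by blast
qed


section \<open>A theorem of the alternative for linear functionals\<close>

lemma linear_negative_perturbation:
  fixes f :: "'i \<Rightarrow> 'x::real_vector \<Rightarrow> real"
  assumes "finite I" and lin: "\<And>i. i \<in> I \<Longrightarrow> linear (f i)" and neg: "\<And>i. i \<in> I \<Longrightarrow> f i x < 0"
  obtains e where "e > 0" "\<And>i. i \<in> I \<Longrightarrow> f i (x + e *\<^sub>R z) < 0"
proof -
  have "\<forall>i\<in>I. \<forall>\<^sub>F e in at_right (0::real). f i x + e * f i z < 0"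
  proof
    fix i assume i: "i \<in> I"
    have "((\<lambda>e. f i x + e * f i z) \<longlongrightarrow> f i x + 0 * f i z) (at_right 0)"
      by (intro tendsto_intros)
    then show "\<forall>\<^sub>F e in at_right (0::real). f i x + e * f i z < 0"
      using neg[OF i] by (intro order_tendstoD(2)) auto
  qed
  then have "\<forall>\<^sub>F e in at_right (0::real). \<forall>i\<in>I. f i x + e * f i z < 0"
    using \<open>finite I\<close> by (simp add: eventually_ball_finite)
  moreover have "\<forall>\<^sub>F e in at_right (0::real). e > 0"
    by (simp add: eventually_at_right_less)
  ultimately have "\<forall>\<^sub>F e in at_right (0::real). e > 0 \<and> (\<forall>i\<in>I. f i x + e * f i z < 0)"
    by (simp add: eventually_conj_iff)
  then obtain e :: real where "e > 0" "\<forall>i\<in>I. f i x + e * f i z < 0"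
    using eventually_happens trivial_limit_at_right_real by blast
  then show thesis
    using that[of e] lin by (simp add: linear_add linear_scale)
qed

text \<open>
  Gordan's theorem: if finitely many linear functionals are never negative simultaneously, then
  \<open>0\<close> is a convex combination of them. The induction eliminates one functional \<open>f j\<close>. If the
  others can be made negative at a point \<open>x\<close>, then \<open>f j x > 0\<close> unless \<open>f j\<close> is zero; adding suitable positive multiples of
  \<open>f j\<close> to the others produces functionals that vanish at \<open>x\<close>. They satisfy the hypothesis again:
  negativity at a point \<open>y\<close> is unaffected by moving \<open>y\<close> along \<open>x\<close> into the kernel of \<open>f j\<close>, where
  the original functionals would be negative, and a small perturbation would make \<open>f j\<close> negative
  too.
\<close>

lemma gordan_alternative:
  fixes f :: "'i \<Rightarrow> 'x::real_vector \<Rightarrow> real"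
  assumes "finite I" and "\<And>i. i \<in> I \<Longrightarrow> linear (f i)" and "\<And>x. \<exists>i\<in>I. 0 \<le> f i x"
  shows "\<exists>c. (\<forall>i\<in>I. 0 \<le> c i) \<and> sum c I = (1::real) \<and> (\<forall>x. (\<Sum>i\<in>I. c i * f i x) = 0)"
  using assms
proof (induction I arbitrary: f rule: finite_induct)
  case empty
  then show ?case by simp
next
  case (insert j I)
  have lin: "linear (f j)" "\<And>i. i \<in> I \<Longrightarrow> linear (f i)"
    using insert.prems(1) by auto
  have upd: "sum (c(j := a)) (insert j I) = a + sum c I"
      "(\<Sum>i\<in>insert j I. (c(j := a)) i * f i x) = a * f j x + (\<Sum>i\<in>I. c i * f i x)"
    for c :: "'i \<Rightarrow> real" and a x
    using insert.hyps by (auto intro!: sum.cong arg_cong2[of _ _ _ _ "(+)"])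
  consider "\<forall>x. \<exists>i\<in>I. 0 \<le> f i x" | "\<forall>x. f j x = 0"
    | x z where "\<forall>i\<in>I. f i x < 0" "f j z < 0"
  proof -
    have "\<exists>z. f j z < 0" if "f j z \<noteq> 0" for z
      using that linear_neg[OF lin(1), of z] by (metis neg_less_0_iff_less not_less_iff_gr_or_eq)
    then show thesis using that by (meson not_le)
  qed
  then show ?case
  proof cases
    case 1
    then obtain c where "\<forall>i\<in>I. 0 \<le> c i" "sum c I = 1" "\<forall>x. (\<Sum>i\<in>I. c i * f i x) = 0"
      using insert.IH[of f] lin(2) by blast
    then show ?thesis
      by (intro exI[of _ "c(j := 0)"]) (simp add: upd del: fun_upd_apply, simp)
  next
    case 2
    then show ?thesis
      using upd[of "\<lambda>_. 0" 1] by (intro exI[of _ "(\<lambda>_. 0)(j := 1)"]) (simp del: fun_upd_apply, simp)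
  next
    case (3 x z)
    \<comment> \<open>such a point \<open>y\<close> could be pushed slightly towards \<open>z\<close>, where \<open>f j\<close> is negative\<close>
    have no_zero: False if "f j y = 0" "\<forall>i\<in>I. f i y < 0" for y
    proof -
      obtain e where e: "e > 0" "\<And>i. i \<in> I \<Longrightarrow> f i (y + e *\<^sub>R z) < 0"
        using linear_negative_perturbation[of I f y z] insert.hyps(1) lin(2) \<open>\<forall>i\<in>I. f i y < 0\<close>
        by blast
      have "f j (y + e *\<^sub>R z) < 0"
        using e(1) that(1) 3(2) by (simp add: linear_add[OF lin(1)] linear_scale[OF lin(1)]
            mult_pos_neg)
      with e(2) insert.prems(2)[of "y + e *\<^sub>R z"] show False by force
    qed
    have "0 \<le> f j x" using insert.prems(2)[of x] 3(1) by force
    with no_zero[of x] 3(1) have pos: "0 < f j x" by force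
    \<comment> \<open>\<open>k i\<close> is the multiple for which \<open>f i + k i * f j\<close> vanishes at \<open>x\<close>\<close>
    define k where "k i = - f i x / f j x" for i
    have k: "0 < k i" if "i \<in> I" for i
      using 3(1) pos that by (simp add: k_def divide_neg_pos)
    define g where "g i y = f i y + k i * f j y" for i y
    have "linear (g i)" if "i \<in> I" for i
      using lin(1) lin(2)[OF that] unfolding g_def
      by (intro linearI) (simp_all add: linear_add linear_scale algebra_simps)
    moreover have "\<exists>i\<in>I. 0 \<le> g i y" for y
    proof (rule ccontr)
      assume "\<not> ?thesis"
      then have neg: "\<forall>i\<in>I. g i y < 0" by force
      let ?y = "y - (f j y / f j x) *\<^sub>R x"
      have "f j ?y = 0"
        using pos by (simp add: linear_diff[OF lin(1)] linear_scale[OF lin(1)])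
      moreover have "f i ?y = g i y" if "i \<in> I" for i
        using lin(2)[OF that] by (simp add: linear_diff linear_scale g_def k_def)
      ultimately show False using no_zero[of ?y] neg by auto
    qed
    ultimately obtain c where c: "\<forall>i\<in>I. 0 \<le> c i" "sum c I = 1" "\<forall>y. (\<Sum>i\<in>I. c i * g i y) = 0"
      using insert.IH[of g] by blast
    \<comment> \<open>\<open>a\<close> is the coefficient of \<open>f j\<close> after expanding \<open>g\<close>; dividing by \<open>1 + a\<close> restores total weight 1\<close>
    define a where "a = (\<Sum>i\<in>I. c i * k i)"
    have a: "0 \<le> a" unfolding a_def using c(1) k by (intro sum_nonneg) (simp add: less_imp_le)
    have zero: "a * f j y + (\<Sum>i\<in>I. c i * f i y) = 0" for y
      using c(3)[rule_format, of y]
      by (simp add: g_def a_def algebra_simps sum.distrib sum_distrib_left)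
    let ?c = "(\<lambda>i. c i / (1 + a))(j := a / (1 + a))"
    have "sum ?c (insert j I) = 1"
      unfolding upd using a c(2) by (simp add: add_divide_distrib[symmetric] flip: sum_divide_distrib)
    moreover have "(\<Sum>i\<in>insert j I. ?c i * f i y) = 0" for y
    proof -
      have "(\<Sum>i\<in>insert j I. ?c i * f i y) = (a * f j y + (\<Sum>i\<in>I. c i * f i y)) / (1 + a)"
        unfolding upd by (simp add: add_divide_distrib sum_divide_distrib)
      then show ?thesis by (simp add: zero)
    qed
    moreover have "\<forall>i\<in>insert j I. 0 \<le> ?c i"
      using a c(1) by simp
    ultimately show ?thesis by blast
  qed
qed


section \<open>The lattice graph generated by a linear graph\<close>

inductive_set sup_closure :: "'v::lattice set \<Rightarrow> 'v set" for S
  where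
    base: "x \<in> S \<Longrightarrow> x \<in> sup_closure S"
  | sup: "x \<in> sup_closure S \<Longrightarrow> y \<in> sup_closure S \<Longrightarrow> sup x y \<in> sup_closure S"

lemma sup_closure_add:
  fixes S :: "'v::vector_lattice set"
  assumes S: "subspace S" and x: "x \<in> sup_closure S" and y: "y \<in> sup_closure S"
  shows "x + y \<in> sup_closure S"
  using x
proof induction
  case (base x)
  from y base show ?case
    by induction (auto simp: add_sup_distrib_left
        intro: sup_closure.intros subspace_add[OF S])
next
  case (sup x x')
  then show ?case by (simp add: add_sup_distrib_right sup_closure.sup)
qed

lemma sup_closure_scaleR:
  fixes S :: "'v::vector_lattice set"
  assumes S: "subspace S" and x: "x \<in> sup_closure S" and "0 \<le> c"
  shows "c *\<^sub>R x \<in> sup_closure S"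
  using x
  by induction (auto simp: scaleR_sup_distrib \<open>0 \<le> c\<close>
      intro: sup_closure.intros subspace_scale[OF S])

text \<open>
  The differences of finite suprema form the vector sublattice generated by \<open>S\<close>; they are closed
  under \<open>sup\<close> because the subtracted terms can be moved to a common one.
\<close>

lemma vector_sublattice_sup_closure_differences:
  fixes S :: "'v::vector_lattice set"
  assumes S: "subspace S"
  shows "vector_sublattice {p - q |p q. p \<in> sup_closure S \<and> q \<in> sup_closure S}"
    (is "vector_sublattice ?D")
proof (rule vector_sublatticeI)
  have D: "p - q \<in> ?D" if "p \<in> sup_closure S" "q \<in> sup_closure S" for p q
    using that by blast
  show "subspace ?D"
    unfolding subspace_def
  proof (intro conjI ballI allI)
    show "0 \<in> ?D" using D[of 0 0] sup_closure.base[OF subspace_0[OF S]] by simp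
    show "x + y \<in> ?D" if "x \<in> ?D" "y \<in> ?D" for x y
    proof -
      obtain p q p' q' where pq: "x = p - q" "y = p' - q'" and mem: "p \<in> sup_closure S"
        "q \<in> sup_closure S" "p' \<in> sup_closure S" "q' \<in> sup_closure S"
        using \<open>x \<in> ?D\<close> \<open>y \<in> ?D\<close> by blast
      have "x + y = (p + p') - (q + q')" by (simp add: pq)
      then show ?thesis using D mem by (simp only: sup_closure_add[OF S])
    qed
    show "c *\<^sub>R x \<in> ?D" if "x \<in> ?D" for c x
    proof -
      obtain p q where pq: "x = p - q" "p \<in> sup_closure S" "q \<in> sup_closure S"
        using \<open>x \<in> ?D\<close> by blast
      show ?thesis
      proof (cases "0 \<le> c")
        case True
        have "c *\<^sub>R x = c *\<^sub>R p - c *\<^sub>R q" by (simp add: pq scaleR_diff_right)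
        then show ?thesis using D pq True by (simp only: sup_closure_scaleR[OF S])
      next
        case False
        then have "0 \<le> - c" by simp
        moreover have "c *\<^sub>R x = (- c) *\<^sub>R q - (- c) *\<^sub>R p" by (simp add: pq scaleR_diff_right)
        ultimately show ?thesis using D pq by (simp only: sup_closure_scaleR[OF S])
      qed
    qed
  qed
  show "sup x y \<in> ?D" if "x \<in> ?D" "y \<in> ?D" for x y
  proof -
    obtain p q p' q' where pq: "x = p - q" "y = p' - q'" and mem: "p \<in> sup_closure S"
      "q \<in> sup_closure S" "p' \<in> sup_closure S" "q' \<in> sup_closure S"
      using \<open>x \<in> ?D\<close> \<open>y \<in> ?D\<close> by blast
    have "sup x y + (q + q') = sup (p + q') (p' + q)"
      unfolding pq add_sup_distrib_right by (simp add: algebra_simps)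
    then have "sup x y = sup (p + q') (p' + q) - (q + q')"
      by (metis add_diff_cancel_right')
    then show ?thesis using D mem by (simp only: sup_closure.sup sup_closure_add[OF S])
  qed
qed

text \<open>
  At each point a finite supremum of real functions is attained by one of its members, while
  in the second coordinate only the upper bound property survives. The transfer of inequalities
  from functions to \<open>'w\<close> uses exactly these two.
\<close>

lemma sup_closure_pointwise_attained:
  fixes S :: "(('x \<Rightarrow> real) \<times> 'w::vector_lattice) set"
  assumes "z \<in> sup_closure S"
  shows "\<exists>Q. finite Q \<and> Q \<subseteq> S \<and> (\<forall>q\<in>Q. q \<le> z) \<and> (\<forall>\<xi>. \<exists>q\<in>Q. fst z \<xi> \<le> fst q \<xi>)"
  using assms
proof induction
  case (base x)
  then show ?case by (intro exI[of _ "{x}"]) auto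
next
  case (sup x y)
  then obtain P Q where
    P: "finite P" "P \<subseteq> S" "\<forall>q\<in>P. q \<le> x" "\<forall>\<xi>. \<exists>q\<in>P. fst x \<xi> \<le> fst q \<xi>" and
    Q: "finite Q" "Q \<subseteq> S" "\<forall>q\<in>Q. q \<le> y" "\<forall>\<xi>. \<exists>q\<in>Q. fst y \<xi> \<le> fst q \<xi>"
    by blast
  have "\<forall>q\<in>P \<union> Q. q \<le> sup x y"
    using P(3) Q(3) by (auto intro: le_supI1 le_supI2)
  moreover have "\<exists>q\<in>P \<union> Q. fst (sup x y) \<xi> \<le> fst q \<xi>" for \<xi>
  proof (cases "fst x \<xi> \<le> fst y \<xi>")
    case True
    then show ?thesis using Q(4) by (force simp: sup_real_def)
  next
    case False
    then show ?thesis using P(4) by (force simp: sup_real_def)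
  qed
  ultimately show ?case using P Q by (intro exI[of _ "P \<union> Q"]) auto
qed

text \<open>
  For \<open>x \<in> S\<close>, Gordan's theorem applied to the differences \<open>q - x\<close>, where \<open>q\<close> runs through the
  members of the supremum \<open>z\<close>, gives a convex combination of the \<open>q\<close> whose first coordinate is that
  of \<open>x\<close>. Since \<open>S\<close> is a linear graph, the second coordinates coincide too, and a convex
  combination of the \<open>q\<close> lies below \<open>z\<close>.
\<close>

lemma sup_closure_order_transfer:
  fixes S :: "(('x::real_vector \<Rightarrow> real) \<times> 'w::vector_lattice) set"
  assumes S: "subspace S" and lin: "\<And>s. s \<in> S \<Longrightarrow> linear (fst s)"
    and single: "\<And>y. (0, y) \<in> S \<Longrightarrow> y = 0"
    and x: "x \<in> sup_closure S" and z: "z \<in> sup_closure S" and le: "fst x \<le> fst z"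
  shows "snd x \<le> snd z"
  using x le
proof induction
  case (base p)
  obtain Q where Q: "finite Q" "Q \<subseteq> S" "\<forall>q\<in>Q. q \<le> z" "\<forall>\<xi>. \<exists>q\<in>Q. fst z \<xi> \<le> fst q \<xi>"
    using sup_closure_pointwise_attained[OF z] by blast
  have "\<exists>q\<in>Q. 0 \<le> fst (q - p) \<xi>" for \<xi>
  proof -
    obtain q where q: "q \<in> Q" "fst z \<xi> \<le> fst q \<xi>" using Q(4) by blast
    moreover have "fst p \<xi> \<le> fst z \<xi>" using base(2) by (simp add: le_fun_def)
    ultimately show ?thesis by (intro bexI[of _ q]) simp_all
  qed
  moreover have "linear (fst (q - p))" if "q \<in> Q" for q
    using that Q(2) base(1) by (intro lin subspace_diff[OF S]) auto
  ultimately obtain c where c: "\<forall>q\<in>Q. 0 \<le> c q" "sum c Q = 1"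
    "\<forall>\<xi>. (\<Sum>q\<in>Q. c q * fst (q - p) \<xi>) = 0"
    using gordan_alternative[OF Q(1), of "\<lambda>q. fst (q - p)"] by blast
  let ?m = "\<Sum>q\<in>Q. c q *\<^sub>R (q - p)"
  have "?m \<in> S"
    using Q(2) base(1) by (intro subspace_sum[OF S] subspace_scale[OF S] subspace_diff[OF S]) auto
  moreover have "fst ?m = 0"
  proof
    fix \<xi>
    have "(\<Sum>q\<in>R. fst (c q *\<^sub>R (q - p))) \<xi> = (\<Sum>q\<in>R. c q * fst (q - p) \<xi>)" if "finite R" for R
      using that by induction (simp_all add: scaleR_fun_def)
    then show "fst ?m \<xi> = 0 \<xi>"
      using c(3) Q(1) by (simp only: fst_sum zero_fun_def)
  qed
  ultimately have "(0, snd ?m) \<in> S"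
    by (metis (no_types) surjective_pairing)
  then have "snd ?m = 0" by (rule single)
  then have "(\<Sum>q\<in>Q. c q *\<^sub>R (snd q - snd p)) = 0"
    by (simp add: snd_sum)
  then have "(\<Sum>q\<in>Q. c q *\<^sub>R snd q) = snd p"
    using c(2) by (simp add: scaleR_diff_right sum_subtractf flip: scaleR_sum_left)
  moreover have "(\<Sum>q\<in>Q. c q *\<^sub>R snd q) \<le> (\<Sum>q\<in>Q. c q *\<^sub>R snd z)"
    using Q(3) c(1) by (intro sum_mono scaleR_left_mono) (auto simp: less_eq_prod_def)
  moreover have "(\<Sum>q\<in>Q. c q *\<^sub>R snd z) = snd z"
    using c(2) by (simp flip: scaleR_sum_left)
  ultimately show ?case by simp
next
  case (sup x y)
  have "fst x \<le> fst (sup x y)" "fst y \<le> fst (sup x y)"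
    unfolding fst_sup by (rule sup_ge1 sup_ge2)+
  then have "snd x \<le> snd z" "snd y \<le> snd z"
    using sup by (meson order_trans)+
  then show ?case by simp
qed

lemma linear_graph_extends_to_lattice_graph:
  fixes S :: "(('x::real_vector \<Rightarrow> real) \<times> 'w::vector_lattice) set"
  assumes S: "subspace S" and lin: "\<And>s. s \<in> S \<Longrightarrow> linear (fst s)"
    and single: "\<And>y. (0, y) \<in> S \<Longrightarrow> y = 0"
    and E: "vector_sublattice E" and SE: "S \<subseteq> UNIV \<times> E"
  obtains H where "S \<subseteq> H" "lattice_graph E H"
proof -
  let ?D = "{p - q |p q. p \<in> sup_closure S \<and> q \<in> sup_closure S}"
  have inE: "snd p \<in> E" if "p \<in> sup_closure S" for p
    using that by induction (use SE in \<open>auto intro: vector_sublattice_closed[OF E]\<close>)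
  have "y = 0" if "(0, y) \<in> ?D" for y
  proof -
    obtain p q where pq: "(0, y) = p - q" "p \<in> sup_closure S" "q \<in> sup_closure S"
      using \<open>(0, y) \<in> ?D\<close> by blast
    have "fst p - fst q = 0" "snd p - snd q = y"
      using arg_cong[OF pq(1), of fst] arg_cong[OF pq(1), of snd] by simp_all
    moreover from this have "snd p \<le> snd q" "snd q \<le> snd p"
      using pq by (intro sup_closure_order_transfer[OF S lin single]; simp)+
    ultimately show ?thesis by simp
  qed
  moreover have "?D \<subseteq> UNIV \<times> E"
    using inE by (auto simp: mem_Times_iff intro!: vector_sublattice_diff[OF E])
  ultimately have "lattice_graph E ?D"
    unfolding lattice_graph_def
    using vector_sublattice_sup_closure_differences[OF S] by blast
  moreover have "S \<subseteq> ?D"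
  proof
    fix s assume "s \<in> S"
    then show "s \<in> ?D"
      by (intro CollectI exI[of _ s] exI[of _ 0])
        (auto intro: sup_closure.base subspace_0[OF S])
  qed
  ultimately show thesis using that by blast
qed


section \<open>The free uniformly complete vector lattice\<close>

lemma inj_point_eval: "inj point_eval"
proof (rule injI)
  fix a b :: 'a assume "point_eval a = point_eval b"
  from fun_cong[OF this, of "\<lambda>c. if c = a then 1 else 0"] show "a = b"
    by (auto simp: point_eval_def split: if_splits)
qed

text \<open>
  The value at the indicator function of \<open>{a}\<close> separates \<open>\<delta>\<^sub>a\<close> from the span of the other point
  evaluations.
\<close>

lemma independent_point_eval: "independent (range point_eval)"
proof
  assume "dependent (range (point_eval :: 'a \<Rightarrow> ('a \<Rightarrow> real) \<Rightarrow> real))"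
  then obtain a :: 'a where a: "point_eval a \<in> span (range point_eval - {point_eval a})"
    unfolding dependent_def by blast
  let ?K = "{x :: ('a \<Rightarrow> real) \<Rightarrow> real. x (\<lambda>b. if b = a then 1 else 0) = 0}"
  have "subspace ?K"
    by (auto simp: subspace_def scaleR_fun_def)
  moreover have "range point_eval - {point_eval a} \<subseteq> ?K"
    by (auto simp: point_eval_def)
  ultimately have "point_eval a \<in> ?K"
    using a span_minimal by blast
  then show False by (simp add: point_eval_def)
qed

lemma linear_point_eval_span:
  assumes "x \<in> span (range point_eval)"
  shows "linear x"
proof -
  have "subspace {x :: ('a \<Rightarrow> real) \<Rightarrow> real. linear x}"
    by (auto simp: subspace_def linear_iff scaleR_fun_def algebra_simps)
  moreover have "range point_eval \<subseteq> {x :: ('a \<Rightarrow> real) \<Rightarrow> real. linear x}"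
    by (auto simp: linear_iff point_eval_def scaleR_fun_def)
  ultimately show ?thesis using assms span_minimal by blast
qed

text \<open>
  The functions in the span of the point evaluations are linear functionals on \<open>'a \<Rightarrow> real\<close>, which
  is what Gordan's theorem acts on.
\<close>

lemma point_eval_lattice_graph:
  fixes q :: "'a \<Rightarrow> 'e::vector_lattice"
  assumes E: "vector_sublattice E" and q: "range q \<subseteq> E"
  obtains H where "lattice_graph E H" "\<And>a. (point_eval a, q a) \<in> H"
proof -
  obtain g where g: "linear g" "\<And>x. x \<in> range point_eval \<Longrightarrow> g x = q (inv point_eval x)"
    using linear_independent_extend[OF independent_point_eval, of "\<lambda>x. q (inv point_eval x)"]
    by blast
  have gq: "g (point_eval a) = q a" for a
    using g(2) by (simp add: inv_f_f[OF inj_point_eval])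
  let ?S = "(\<lambda>x. (x, g x)) ` span (range point_eval)"
  have sub: "subspace ?S"
    by (intro linear_subspace_image subspace_span linearI)
      (simp_all add: linear_add[OF g(1)] linear_scale[OF g(1)])
  have "g x \<in> E" if "x \<in> span (range point_eval)" for x
  proof -
    have "g x \<in> span (g ` range point_eval)"
      using that by (simp add: linear_span_image[OF g(1)])
    also have "\<dots> \<subseteq> E"
      using q gq by (intro span_minimal vector_sublattice_subspace[OF E]) auto
    finally show ?thesis .
  qed
  then have SE: "?S \<subseteq> UNIV \<times> E" by auto
  have lin: "linear (fst s)" if "s \<in> ?S" for s
    using that linear_point_eval_span by auto
  have single: "y = 0" if "(0, y) \<in> ?S" for y
    using that linear_0[OF g(1)] by auto
  obtain H where "?S \<subseteq> H" "lattice_graph E H"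
    by (rule linear_graph_extends_to_lattice_graph[OF sub lin single E SE])
  moreover have "(point_eval a, q a) \<in> ?S" for a
    by (rule image_eqI[of _ _ "point_eval a"]) (simp_all add: gq span_base)
  ultimately show thesis by (intro that[of H]) (assumption, rule subsetD)
qed

lemma riesz_hom_on_subset: "riesz_hom_on V T \<Longrightarrow> W \<subseteq> V \<Longrightarrow> riesz_hom_on W T"
  unfolding riesz_hom_on_def by (meson subsetD)

lemma riesz_hom_on_cong:
  assumes "vector_sublattice V" "riesz_hom_on V T" "\<And>x. x \<in> V \<Longrightarrow> S x = T x"
  shows "riesz_hom_on V S"
  using assms(2,3) unfolding riesz_hom_on_def
  by (auto simp: vector_sublattice_closed[OF assms(1)])

theorem corollary2:
  fixes F :: "(('a \<Rightarrow> real) \<Rightarrow> real) set"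
  assumes "F = \<Inter> {V. vector_sublattice V \<and> ucvl V \<and> range point_eval \<subseteq> V}"
  shows "free_ucvl TYPE('e::vector_lattice) F (point_eval :: 'a \<Rightarrow> ('a \<Rightarrow> real) \<Rightarrow> real)"
  unfolding free_ucvl_def
proof (intro conjI allI impI)
  have least: "F \<subseteq> V" if "ucvl V" "range point_eval \<subseteq> V" for V
    using that unfolding assms by (auto simp: ucvl_def)
  show ucvl_F: "ucvl F"
    unfolding assms by (rule ucvl_Inter[OF ucvl_fun_UNIV]) simp
  then have F: "vector_sublattice F" by (simp add: ucvl_def)
  show gen: "range point_eval \<subseteq> F" unfolding assms by blast
  show "inj (point_eval :: 'a \<Rightarrow> _)" by (rule inj_point_eval)
  fix E :: "'e set" and q :: "'a \<Rightarrow> 'e"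
  assume "ucvl E \<and> range q \<subseteq> E \<and> inj q"
  then have E: "ucvl E" and q: "range q \<subseteq> E" by simp_all
  then have E': "vector_sublattice E" "archimedean_on E" by (auto simp: ucvl_def)
  obtain H where H: "lattice_graph E H" "\<And>a. (point_eval a, q a) \<in> H"
    using point_eval_lattice_graph[OF E'(1) q] by blast
  obtain M where M: "H \<subseteq> M" "lattice_graph E M" "ucvl (fst ` M)"
    using lattice_graph_extension[OF ucvl_fun_UNIV E H(1)] by blast
  obtain T where T: "\<And>z. z \<in> M \<Longrightarrow> T (fst z) = snd z" "riesz_hom_on (fst ` M) T"
    "T ` fst ` M \<subseteq> E"
    using lattice_graph_riesz_hom[OF M(2)] by blast
  have T_gen: "T (point_eval a) = q a" for a
    using T(1)[OF subsetD[OF M(1) H(2)], of a] by simp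
  have "range point_eval \<subseteq> fst ` M"
    using H(2) M(1) by force
  then have dom: "F \<subseteq> fst ` M" by (rule least[OF M(3)])
  have T_F: "T ` F \<subseteq> E" using image_mono[OF dom] T(3) by (rule order_trans)
  show "\<exists>!T. T \<in> F \<rightarrow>\<^sub>E E \<and> riesz_hom_on F T \<and> (\<forall>a. q a = T (point_eval a))"
  proof (rule ex1I[of _ "restrict T F"], intro conjI allI)
    show "restrict T F \<in> F \<rightarrow>\<^sub>E E"
      using T_F by auto
    show "riesz_hom_on F (restrict T F)"
      using riesz_hom_on_subset[OF T(2) dom] by (rule riesz_hom_on_cong[OF F]) simp
    show "q a = restrict T F (point_eval a)" for a
      using gen T_gen by auto
  next
    fix S assume S: "S \<in> F \<rightarrow>\<^sub>E E \<and> riesz_hom_on F S \<and> (\<forall>a. q a = S (point_eval a))"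
    have "ucvl {x \<in> F. S x = T x}"
      using S T_F
      by (intro ucvl_equalizer[OF ucvl_F E'] riesz_hom_on_subset[OF T(2) dom]) auto
    moreover have "range point_eval \<subseteq> {x \<in> F. S x = T x}"
      using gen S T_gen by auto
    ultimately have "F \<subseteq> {x \<in> F. S x = T x}" by (rule least)
    with S show "S = restrict T F"
      by (intro extensionalityI[of _ F]) (auto simp: PiE_iff)
  qed
qed

end
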